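(* For every integer $n\geq 1$ and every integer $k\geq 3$, let $\mu=\min\{\frac{2k-2}{2k+1}n+5,\ \frac{k+2}{k+4}n+2\}$. There exists an $n$-vertex planar graph $G$ such that every set $\mathcal I\subseteq V(G)$ for which $G[\mathcal I]$ has maximum degree at most $k$ satisfies $|\mathcal I|\leq\mu$.
   Context: Planar graphs are simple graphs admitting a crossing-free drawing in the plane. $G[\mathcal I]$ denotes the subgraph of $G$ induced by $\mathcal I$. *)

theory Defs
  imports "Graph_Theory.Graph_Theory" "HOL-Analysis.Analysis"
begin

text \<open>
  A finite simple graph is a \<open>pair_graph\<close>, that is, a finite symmetric loopfree set of ordered pairs;
  the undirected edge between \<open>u\<close> and \<open>v\<close> is represented by both \<open>(u, v)\<close> and \<open>(v, u)\<close>.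
  A drawing assigns one curve to each undirected edge \<open>{u, v}\<close>, so that both orientations share it.
\<close>

definition plane_drawing ::
  "'a pair_pre_digraph \<Rightarrow> ('a \<Rightarrow> complex) \<Rightarrow> ('a set \<Rightarrow> real \<Rightarrow> complex) \<Rightarrow> bool" where
  "plane_drawing G p c \<longleftrightarrow>
     inj_on p (pverts G) \<and>
     (\<forall>(u, v) \<in> parcs G.
        Path_Connected.arc (c {u, v}) \<and>
        {pathstart (c {u, v}), pathfinish (c {u, v})} = {p u, p v} \<and>
        path_image (c {u, v}) \<inter> p ` pverts G = {p u, p v}) \<and>
     (\<forall>(u, v) \<in> parcs G. \<forall>(x, y) \<in> parcs G.
        {u, v} \<noteq> {x, y} \<longrightarrow>
        path_image (c {u, v}) \<inter> path_image (c {x, y}) = p ` ({u, v} \<inter> {x, y}))"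

definition planar_graph :: "'a pair_pre_digraph \<Rightarrow> bool" where
  "planar_graph G \<longleftrightarrow> pair_graph G \<and> (\<exists>p c. plane_drawing G p c)"

text \<open>
  In a symmetric digraph without multiple arcs the out-degree of a vertex is its number of neighbours.
  The inserted \<open>0\<close> only matters for the graph without vertices, whose maximum degree is thus \<open>0\<close>.
\<close>

definition max_degree :: "('a, 'b) pre_digraph \<Rightarrow> nat" where
  "max_degree H = Max (insert 0 (out_degree H ` verts H))"

lemma max_degree_le_iff:
  "finite (verts H) \<Longrightarrow> max_degree H \<le> k \<longleftrightarrow> (\<forall>v \<in> verts H. out_degree H v \<le> k)"
  by (simp add: max_degree_def)

end

theory Submission
  imports Defs
begin

text \<open>
  Suppose that \<open>H\<close> and \<open>L\<close> are disjoint sets of vertices, called hubs and leaves, such that every hub has at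
  least \<open>k + 1\<close> leaf neighbours and the hubs at any leaf are pairwise adjacent. Then at least
  \<open>card H\<close> vertices have to be deleted to reduce the maximum degree to \<open>k\<close>. Two planar graphs of this kind
  suffice: two adjacent hubs with \<open>k + 1\<close> common leaves (\<open>k + 3\<close> vertices, \<open>2\<close> deletions) and, for
  \<open>k \<le> 6\<close>, an octahedron of hubs with a leaf in each face and \<open>k - 3\<close> leaves along each edge of a perfect
  matching (\<open>3 k + 5\<close> vertices, \<open>6\<close> deletions). The extremal graph consists of as many disjoint
  copies of the larger of these graphs as fit into \<open>n\<close> vertices, then copies of the smaller one,
  then isolated vertices.
\<close>

section \<open>Straight-line drawings\<close>

text \<open>Storing one orientation per edge keeps the crossing tests few; the union with the
  converse makes the arc set symmetric.\<close>

definition ugraph :: "'a set \<Rightarrow> 'a rel \<Rightarrow> 'a pair_pre_digraph" where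
  "ugraph V E = \<lparr>pverts = V, parcs = E \<union> E\<inverse>\<rparr>"

lemma ugraph_simps [simp]: "pverts (ugraph V E) = V" "parcs (ugraph V E) = E \<union> E\<inverse>"
  by (simp_all add: ugraph_def)

lemma pair_graphI:
  assumes "finite V" "E \<subseteq> V \<times> V" "sym E" "irrefl E"
  shows "pair_graph \<lparr>pverts = V, parcs = E\<rparr>"
proof -
  have "finite E"
    using assms finite_subset by blast
  then show ?thesis
    using assms by unfold_locales (auto simp: symmetric_def irrefl_def)
qed

lemma pair_graph_ugraph:
  assumes "finite V" "E \<subseteq> V \<times> V" "irrefl E"
  shows "pair_graph (ugraph V E)"
  unfolding ugraph_def using assms
  by (intro pair_graphI) (auto simp: sym_def irrefl_def)

text \<open>Twice the signed area of the triangle \<open>a\<close>, \<open>b\<close>,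
  \<open>c\<close>; the sign tells on which side of the directed line from \<open>a\<close> to
  \<open>b\<close> the point \<open>c\<close> lies. Integer coordinates make the test
  executable.\<close>

definition cross :: "int \<times> int \<Rightarrow> int \<times> int \<Rightarrow> int \<times> int \<Rightarrow> int" where
  "cross a b c = (fst b - fst a) * (snd c - snd a) - (snd b - snd a) * (fst c - fst a)"

definition pt :: "int \<times> int \<Rightarrow> complex" where
  "pt a = Complex (of_int (fst a)) (of_int (snd a))"

text \<open>Extends \<open>cross a b\<close> from lattice points to an affine function on the whole
  plane that vanishes on the line through \<open>a\<close> and \<open>b\<close>.\<close>

definition side :: "int \<times> int \<Rightarrow> int \<times> int \<Rightarrow> complex \<Rightarrow> real" where
  "side a b z = real_of_int (fst b - fst a) * (Im z - real_of_int (snd a))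
               - real_of_int (snd b - snd a) * (Re z - real_of_int (fst a))"

lemma pt_eq_iff [simp]: "pt a = pt b \<longleftrightarrow> a = b"
  by (auto simp: pt_def prod_eq_iff)

lemma side_pt: "side a b (pt c) = of_int (cross a b c)"
  by (simp add: side_def cross_def pt_def)

lemma side_affine: "side a b ((1 - t) *\<^sub>R z + t *\<^sub>R w) = (1 - t) * side a b z + t * side a b w"
  by (simp add: side_def algebra_simps)

lemma side_on_segment: "z \<in> closed_segment (pt a) (pt b) \<Longrightarrow> side a b z = 0"
  by (auto simp: closed_segment_def side_affine side_pt) (simp add: cross_def)

text \<open>If \<open>c\<close> and \<open>d\<close> lie strictly on the same side of the line
  through \<open>a\<close> and \<open>b\<close>, then the affine function \<open>side a b\<close>
  has no zero between them, while it vanishes on the other segment.\<close>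

lemma segments_disjoint:
  assumes "cross a b c * cross a b d > 0"
  shows "closed_segment (pt a) (pt b) \<inter> closed_segment (pt c) (pt d) = {}"
proof -
  have False if z: "z \<in> closed_segment (pt a) (pt b)" "z \<in> closed_segment (pt c) (pt d)" for z
  proof -
    obtain t where t: "0 \<le> t" "t \<le> 1" "z = (1 - t) *\<^sub>R pt c + t *\<^sub>R pt d"
      using z(2) by (auto simp: closed_segment_def)
    define x y where "x = real_of_int (cross a b c)" and "y = real_of_int (cross a b d)"
    have eq: "(1 - t) * x + t * y = 0"
      using side_on_segment[OF z(1)] t(3) by (simp add: side_affine side_pt x_def y_def)
    have "x * y > 0"
      using assms by (simp add: x_def y_def flip: of_int_mult)
    then consider "x > 0" "y > 0" | "x < 0" "y < 0"
      by (auto simp: zero_less_mult_iff)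
    then show False
    proof cases
      case 1
      then have "(1 - t) * x \<ge> 0" "t * y \<ge> 0" using t by simp_all
      then have "(1 - t) * x = 0" "t * y = 0" using eq by linarith+
      then show False using 1 by simp
    next
      case 2
      then have "(1 - t) * x \<le> 0" "t * y \<le> 0" using t by (simp_all add: mult_nonneg_nonpos)
      then have "(1 - t) * x = 0" "t * y = 0" using eq by linarith+
      then show False using 2 by simp
    qed
  qed
  then show ?thesis by blast
qed

text \<open>At parameter \<open>t\<close> of the second segment, \<open>side a b\<close> equals
  \<open>t * cross a b d\<close>, which is zero only for \<open>t = 0\<close>, that is, at the
  common end.\<close>

lemma segments_common_end:
  assumes "cross a b d \<noteq> 0"
  shows "closed_segment (pt a) (pt b) \<inter> closed_segment (pt a) (pt d) \<subseteq> {pt a}"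
proof
  fix z assume z: "z \<in> closed_segment (pt a) (pt b) \<inter> closed_segment (pt a) (pt d)"
  then obtain t where t: "z = (1 - t) *\<^sub>R pt a + t *\<^sub>R pt d"
    by (auto simp: closed_segment_def)
  have "side a b z = 0"
    using z side_on_segment by blast
  then have "t * cross a b d = 0"
    unfolding t side_affine side_pt by (simp add: cross_def)
  then show "z \<in> {pt a}"
    using assms t by simp
qed

text \<open>A sufficient test built from orientation signs only, so that it can be evaluated. The
  alternatives \<open>v = y\<close> and \<open>v = x\<close> let an edge pass against itself in
  either orientation.\<close>

definition noncrossing :: "('a \<Rightarrow> int \<times> int) \<Rightarrow> 'a \<times> 'a \<Rightarrow> 'a \<times> 'a \<Rightarrow> bool" where
  "noncrossing q = (\<lambda>(u, v) (x, y).
     if u = x then v = y \<or> cross (q u) (q v) (q y) \<noteq> 0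
     else if u = y then v = x \<or> cross (q u) (q v) (q x) \<noteq> 0
     else if v = x then cross (q v) (q u) (q y) \<noteq> 0
     else if v = y then cross (q v) (q u) (q x) \<noteq> 0
     else cross (q u) (q v) (q x) * cross (q u) (q v) (q y) > 0 \<or>
          cross (q x) (q y) (q u) * cross (q x) (q y) (q v) > 0)"

lemma noncrossing_segments:
  assumes "noncrossing q (u, v) (x, y)" "{u, v} \<noteq> {x, y}" "u \<noteq> v" "x \<noteq> y"
  shows "closed_segment (pt (q u)) (pt (q v)) \<inter> closed_segment (pt (q x)) (pt (q y))
         = (\<lambda>w. pt (q w)) ` ({u, v} \<inter> {x, y})"
proof
  show "closed_segment (pt (q u)) (pt (q v)) \<inter> closed_segment (pt (q x)) (pt (q y))
        \<subseteq> (\<lambda>w. pt (q w)) ` ({u, v} \<inter> {x, y})"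
  proof -
    consider "u = x" "v \<noteq> y" | "u = y" "v \<noteq> x" "u \<noteq> x" | "v = x" "u \<noteq> x" "u \<noteq> y"
      | "v = y" "u \<noteq> x" "u \<noteq> y" "v \<noteq> x" | "u \<noteq> x" "u \<noteq> y" "v \<noteq> x" "v \<noteq> y"
      using assms by blast
    then show ?thesis
    proof cases
      case 1
      then show ?thesis
        using assms segments_common_end[of "q u" "q v" "q y"] by (auto simp: noncrossing_def)
    next
      case 2
      then show ?thesis
        using assms segments_common_end[of "q u" "q v" "q x"]
        by (auto simp: noncrossing_def closed_segment_commute)
    next
      case 3
      then show ?thesis
        using assms segments_common_end[of "q v" "q u" "q y"]
        by (auto simp: noncrossing_def closed_segment_commute)
    next
      case 4
      then show ?thesis
        using assms segments_common_end[of "q v" "q u" "q x"]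
        by (auto simp: noncrossing_def closed_segment_commute)
    next
      case 5
      then show ?thesis
        using assms segments_disjoint[of "q u" "q v" "q x" "q y"]
          segments_disjoint[of "q x" "q y" "q u" "q v"]
        by (auto simp: noncrossing_def)
    qed
  qed
qed auto

lemma plane_drawing_iff:
  "plane_drawing G p c \<longleftrightarrow>
     inj_on p (pverts G) \<and>
     (\<forall>u v. (u, v) \<in> parcs G \<longrightarrow>
        Path_Connected.arc (c {u, v}) \<and>
        {pathstart (c {u, v}), pathfinish (c {u, v})} = {p u, p v} \<and>
        path_image (c {u, v}) \<inter> p ` pverts G = {p u, p v}) \<and>
     (\<forall>u v. (u, v) \<in> parcs G \<longrightarrow> (\<forall>x y. (x, y) \<in> parcs G \<longrightarrow>
        {u, v} \<noteq> {x, y} \<longrightarrow>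
        path_image (c {u, v}) \<inter> path_image (c {x, y}) = p ` ({u, v} \<inter> {x, y})))"
  by (simp only: plane_drawing_def Ball_def split_paired_All prod.case)

lemma plane_drawingI:
  assumes "inj_on p (pverts G)"
    and "\<And>u v. (u, v) \<in> parcs G \<Longrightarrow> Path_Connected.arc (c {u, v})"
    and "\<And>u v. (u, v) \<in> parcs G \<Longrightarrow> {pathstart (c {u, v}), pathfinish (c {u, v})} = {p u, p v}"
    and "\<And>u v. (u, v) \<in> parcs G \<Longrightarrow> path_image (c {u, v}) \<inter> p ` pverts G = {p u, p v}"
    and "\<And>u v x y. (u, v) \<in> parcs G \<Longrightarrow> (x, y) \<in> parcs G \<Longrightarrow> {u, v} \<noteq> {x, y} \<Longrightarrow>
           path_image (c {u, v}) \<inter> path_image (c {x, y}) = p ` ({u, v} \<inter> {x, y})"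
  shows "plane_drawing G p c"
  unfolding plane_drawing_iff by (intro conjI allI impI assms)

lemma plane_drawingD:
  assumes "plane_drawing G p c"
  shows "inj_on p (pverts G)"
    and "(u, v) \<in> parcs G \<Longrightarrow> Path_Connected.arc (c {u, v})"
    and "(u, v) \<in> parcs G \<Longrightarrow> {pathstart (c {u, v}), pathfinish (c {u, v})} = {p u, p v}"
    and "(u, v) \<in> parcs G \<Longrightarrow> path_image (c {u, v}) \<inter> p ` pverts G = {p u, p v}"
    and "(u, v) \<in> parcs G \<Longrightarrow> (x, y) \<in> parcs G \<Longrightarrow> {u, v} \<noteq> {x, y} \<Longrightarrow>
           path_image (c {u, v}) \<inter> path_image (c {x, y}) = p ` ({u, v} \<inter> {x, y})"
  using assms unfolding plane_drawing_iff by simp_all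

text \<open>Pairwise tests of edges also keep vertices off foreign edges: a vertex \<open>w\<close>
  on the segment of \<open>{u, v}\<close> has some edge \<open>{w, x}\<close>, and the two segments
  meet only in common ends, so \<open>w\<close> is \<open>u\<close> or \<open>v\<close>. This is why
  every vertex must have an edge.\<close>

lemma planar_straight_line:
  assumes fin: "finite V" and E: "E \<subseteq> V \<times> V" "irrefl E" and q: "inj_on q V"
    and no_isolated: "V \<subseteq> Field E"
    and nc: "\<And>e f. e \<in> E \<Longrightarrow> f \<in> E \<Longrightarrow> noncrossing q e f"
  shows "planar_graph (ugraph V E)"
proof -
  define p where "p = (\<lambda>v. pt (q v))"
  \<comment> \<open>Curves are indexed by unordered pairs but a segment has a direction, so an
    orientation present in \<open>E\<close> is chosen for each edge.\<close>
  define o_edge where "o_edge = (\<lambda>e. SOME (u, v). e = {u, v} \<and> (u, v) \<in> E)"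
  define c where "c = (\<lambda>e. case o_edge e of (u, v) \<Rightarrow> linepath (p u) (p v))"
  have c_edge: "\<exists>x y. (x, y) \<in> E \<and> {x, y} = {u, v} \<and> c {u, v} = linepath (p x) (p y)"
    if "(u, v) \<in> E \<union> E\<inverse>" for u v
  proof -
    have "\<exists>e. case e of (x, y) \<Rightarrow> {u, v} = {x, y} \<and> (x, y) \<in> E"
      using that by auto
    then have "case o_edge {u, v} of (x, y) \<Rightarrow> {u, v} = {x, y} \<and> (x, y) \<in> E"
      unfolding o_edge_def by (rule someI_ex)
    then show ?thesis
      by (auto simp: c_def split: prod.splits)
  qed
  have neq: "u \<noteq> v" if "(u, v) \<in> E" for u v
    using that E(2) by (auto simp: irrefl_def)
  have inter: "path_image (c {u, v}) \<inter> path_image (c {x, y}) = p ` ({u, v} \<inter> {x, y})"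
    if uv: "(u, v) \<in> E \<union> E\<inverse>" and xy: "(x, y) \<in> E \<union> E\<inverse>" and ne: "{u, v} \<noteq> {x, y}" for u v x y
  proof -
    obtain u' v' x' y' where *: "(u', v') \<in> E" "{u', v'} = {u, v}" "c {u, v} = linepath (p u') (p v')"
      "(x', y') \<in> E" "{x', y'} = {x, y}" "c {x, y} = linepath (p x') (p y')"
      using c_edge[OF uv] c_edge[OF xy] by blast
    show ?thesis
      using noncrossing_segments[OF nc[OF *(1) *(4)]] * neq ne by (simp add: p_def)
  qed
  have ends: "Path_Connected.arc (c {u, v})" "{pathstart (c {u, v}), pathfinish (c {u, v})} = {p u, p v}"
    "{p u, p v} \<subseteq> path_image (c {u, v})"
    if uv: "(u, v) \<in> E \<union> E\<inverse>" for u v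
  proof -
    obtain x y where *: "(x, y) \<in> E" "{x, y} = {u, v}" "c {u, v} = linepath (p x) (p y)"
      using c_edge[OF uv] by blast
    have "x \<in> V" "y \<in> V" "x \<noteq> y" using * E neq by auto
    then have "p x \<noteq> p y"
      using q by (auto simp: p_def inj_on_def)
    then show "Path_Connected.arc (c {u, v})" using * by simp
    have "{p x, p y} = p ` {x, y}" "{p u, p v} = p ` {u, v}" by auto
    then have "{p x, p y} = {p u, p v}"
      using *(2) by metis
    then show "{pathstart (c {u, v}), pathfinish (c {u, v})} = {p u, p v}"
      "{p u, p v} \<subseteq> path_image (c {u, v})" using * by auto
  qed
  have p: "inj_on p V"
    using q by (auto simp: p_def inj_on_def)
  have "w \<in> {u, v}" if uv: "(u, v) \<in> E \<union> E\<inverse>" and w: "w \<in> V" "p w \<in> path_image (c {u, v})" for u v w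
  proof (rule ccontr)
    assume w': "w \<notin> {u, v}"
    obtain x where x: "(w, x) \<in> E \<union> E\<inverse>"
      using no_isolated w(1) by (auto simp: Field_def)
    then have "p w \<in> p ` ({u, v} \<inter> {w, x})"
      using inter[OF uv x] w' w ends(3)[OF x] by auto
    then obtain w2 where "w2 \<in> {u, v}" "p w = p w2" by auto
    moreover have "u \<in> V" "v \<in> V" using uv E by auto
    ultimately show False
      using p w(1) w' by (auto simp: inj_on_def)
  qed
  then have "path_image (c {u, v}) \<inter> p ` V = {p u, p v}" if "(u, v) \<in> E \<union> E\<inverse>" for u v
    using that ends(3)[OF that] E by (fastforce simp del: Un_iff)
  then have "plane_drawing (ugraph V E) p c"
    using p ends inter by (intro plane_drawingI) (simp_all only: ugraph_simps)
  then show ?thesis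
    using pair_graph_ugraph[OF fin E] by (auto simp: planar_graph_def)
qed

section \<open>Disjoint unions of planar graphs\<close>

text \<open>Points and curves are pulled back along \<open>inv f\<close>. Such relabelling makes
  vertex sets disjoint before a union is formed.\<close>

lemma planar_graph_map:
  assumes "planar_graph G" "inj f"
  shows "planar_graph \<lparr>pverts = f ` pverts G, parcs = map_prod f f ` parcs G\<rparr>" (is "planar_graph ?G")
proof -
  obtain p c where G: "pair_graph G" and d: "plane_drawing G p c"
    using assms(1) by (auto simp: planar_graph_def)
  interpret pair_graph G by (rule G)
  have "pair_graph ?G"
  proof (rule pair_graphI)
    show "sym (map_prod f f ` parcs G)"
      using pair_sym_arcs by (force simp: symmetric_def sym_def)
    show "irrefl (map_prod f f ` parcs G)"
      using assms(2) no_loops' by (auto simp: irrefl_def dest: injD)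
  qed (auto dest: in_arcsD1 in_arcsD2 simp: pair_finite_verts)
  moreover have "plane_drawing ?G (p \<circ> inv f) (c \<circ> image (inv f))"
  proof (rule plane_drawingI)
    show "inj_on (p \<circ> inv f) (pverts ?G)"
      using plane_drawingD(1)[OF d] assms(2) by (auto simp: inj_on_def)
  next
    fix u v assume "(u, v) \<in> parcs ?G"
    then obtain a b where ab: "(a, b) \<in> parcs G" "u = f a" "v = f b" by auto
    have img: "(p \<circ> inv f) ` pverts ?G = p ` pverts G"
      using assms(2) by (simp add: image_image)
    show "Path_Connected.arc ((c \<circ> image (inv f)) {u, v})"
      using plane_drawingD(2)[OF d ab(1)] ab assms(2) by simp
    show "{pathstart ((c \<circ> image (inv f)) {u, v}), pathfinish ((c \<circ> image (inv f)) {u, v})}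
        = {(p \<circ> inv f) u, (p \<circ> inv f) v}"
      using plane_drawingD(3)[OF d ab(1)] ab assms(2) by simp
    show "path_image ((c \<circ> image (inv f)) {u, v}) \<inter> (p \<circ> inv f) ` pverts ?G
        = {(p \<circ> inv f) u, (p \<circ> inv f) v}"
      using plane_drawingD(4)[OF d ab(1)] ab assms(2) unfolding img by simp
    fix x y assume "(x, y) \<in> parcs ?G" and ne: "{u, v} \<noteq> {x, y}"
    then obtain a' b' where ab': "(a', b') \<in> parcs G" "x = f a'" "y = f b'" by auto
    have "{a, b} \<noteq> {a', b'}" using ne ab ab' by auto
    moreover have "(p \<circ> inv f) ` ({u, v} \<inter> {x, y}) = p ` ({a, b} \<inter> {a', b'})"
    proof -
      have "{u, v} \<inter> {x, y} = f ` ({a, b} \<inter> {a', b'})"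
        using ab ab' assms(2) by (simp add: image_Int)
      then show ?thesis using assms(2) by (simp add: image_comp comp_assoc)
    qed
    ultimately show "path_image ((c \<circ> image (inv f)) {u, v}) \<inter> path_image ((c \<circ> image (inv f)) {x, y})
        = (p \<circ> inv f) ` ({u, v} \<inter> {x, y})"
      using plane_drawingD(5)[OF d ab(1) ab'(1)] ab ab' assms(2) by simp
  qed
  ultimately show ?thesis
    by (auto simp: planar_graph_def)
qed

definition drawing_set :: "'a pair_pre_digraph \<Rightarrow> ('a \<Rightarrow> complex) \<Rightarrow> ('a set \<Rightarrow> real \<Rightarrow> complex) \<Rightarrow> complex set" where
  "drawing_set G p c = p ` pverts G \<union> (\<Union>(u, v)\<in>parcs G. path_image (c {u, v}))"

lemma bounded_drawing_set:
  assumes "pair_graph G" "plane_drawing G p c"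
  shows "bounded (drawing_set G p c)"
proof -
  interpret pair_graph G by (rule assms)
  have "bounded (path_image (c {u, v}))" if "(u, v) \<in> parcs G" for u v
    using plane_drawingD(2)[OF assms(2) that] by (simp add: bounded_arc_image)
  then show ?thesis
    using pair_finite_verts pair_finite_arcs by (auto simp: drawing_set_def finite_imp_bounded)
qed

lemma plane_drawing_translate:
  assumes "plane_drawing G p c"
  shows "plane_drawing G (\<lambda>v. w + p v) (\<lambda>e t. w + c e t)"
proof (rule plane_drawingI)
  have img: "path_image (\<lambda>t. w + g t) = (+) w ` path_image g" for g
    by (auto simp: path_image_def)
  have p: "(\<lambda>v. w + p v) ` S = (+) w ` p ` S" for S by auto
  show "inj_on (\<lambda>v. w + p v) (pverts G)"
    using plane_drawingD(1)[OF assms] by (auto simp: inj_on_def)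
  fix u v assume uv: "(u, v) \<in> parcs G"
  show "Path_Connected.arc (\<lambda>t. w + c {u, v} t)"
    using plane_drawingD(2)[OF assms uv] arc_translation_eq[of w "c {u, v}"] by (simp add: comp_def)
  have "{pathstart (\<lambda>t. w + c {u, v} t), pathfinish (\<lambda>t. w + c {u, v} t)}
      = (+) w ` {pathstart (c {u, v}), pathfinish (c {u, v})}"
    by (simp add: pathstart_def pathfinish_def)
  then show "{pathstart (\<lambda>t. w + c {u, v} t), pathfinish (\<lambda>t. w + c {u, v} t)} = {w + p u, w + p v}"
    using plane_drawingD(3)[OF assms uv] by simp
  show "path_image (\<lambda>t. w + c {u, v} t) \<inter> (\<lambda>v. w + p v) ` pverts G = {w + p u, w + p v}"
    unfolding img p using plane_drawingD(4)[OF assms uv] by (simp flip: image_Int)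
  fix x y assume xy: "(x, y) \<in> parcs G" "{u, v} \<noteq> {x, y}"
  show "path_image (\<lambda>t. w + c {u, v} t) \<inter> path_image (\<lambda>t. w + c {x, y} t)
      = (\<lambda>v. w + p v) ` ({u, v} \<inter> {x, y})"
    unfolding img p using plane_drawingD(5)[OF assms uv xy] by (simp flip: image_Int)
qed

definition graph_union :: "'a pair_pre_digraph \<Rightarrow> 'a pair_pre_digraph \<Rightarrow> 'a pair_pre_digraph" where
  "graph_union G H = \<lparr>pverts = pverts G \<union> pverts H, parcs = parcs G \<union> parcs H\<rparr>"

lemma graph_union_simps [simp]:
  "pverts (graph_union G H) = pverts G \<union> pverts H"
  "parcs (graph_union G H) = parcs G \<union> parcs H"
  by (simp_all add: graph_union_def)

text \<open>As the vertex sets are disjoint, containment of an edge in \<open>pverts G\<close>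
  decides which drawing supplies its curve; pieces from different drawings never meet by
  \<open>far\<close>.\<close>

lemma plane_drawing_union:
  assumes G: "pair_graph G" "plane_drawing G p c" and H: "pair_graph H" "plane_drawing H p' c'"
    and disj: "pverts G \<inter> pverts H = {}" and far: "drawing_set G p c \<inter> drawing_set H p' c' = {}"
  shows "plane_drawing (graph_union G H) (\<lambda>v. if v \<in> pverts G then p v else p' v)
           (\<lambda>e. if e \<subseteq> pverts G then c e else c' e)"
    (is "plane_drawing _ ?p ?c")
proof (rule plane_drawingI)
  interpret G: pair_graph G by (rule G)
  interpret H: pair_graph H by (rule H)
  have pG: "?p ` S = p ` S" if "S \<subseteq> pverts G" for S
    using that by (intro image_cong) auto
  have pH: "?p ` S = p' ` S" if "S \<subseteq> pverts H" for S
    using that disj by (intro image_cong) auto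
  have cG: "?c {u, v} = c {u, v}" "u \<in> pverts G" "v \<in> pverts G" "path_image (c {u, v}) \<subseteq> drawing_set G p c"
    if "(u, v) \<in> parcs G" for u v
    using G.in_arcsD1[OF that] G.in_arcsD2[OF that] that by (auto simp: drawing_set_def)
  have cH: "?c {u, v} = c' {u, v}" "u \<in> pverts H" "v \<in> pverts H" "u \<notin> pverts G" "v \<notin> pverts G"
    "path_image (c' {u, v}) \<subseteq> drawing_set H p' c'"
    if "(u, v) \<in> parcs H" for u v
    using H.in_arcsD1[OF that] H.in_arcsD2[OF that] that disj by (auto simp: drawing_set_def)
  have vG: "p ` pverts G \<subseteq> drawing_set G p c" and vH: "p' ` pverts H \<subseteq> drawing_set H p' c'"
    by (auto simp: drawing_set_def)
  show "inj_on ?p (pverts (graph_union G H))"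
  proof -
    have "inj_on ?p (pverts G)"
      using plane_drawingD(1)[OF G(2)] by (simp cong: inj_on_cong)
    moreover have "inj_on ?p (pverts H) = inj_on p' (pverts H)"
      using disj by (intro inj_on_cong) auto
    with plane_drawingD(1)[OF H(2)] have "inj_on ?p (pverts H)" by simp
    moreover have "?p ` (pverts G - pverts H) \<inter> ?p ` (pverts H - pverts G) = {}"
      unfolding pG[OF Diff_subset] pH[OF Diff_subset] using vG vH far by blast
    ultimately show ?thesis by (simp add: inj_on_Un)
  qed
  have img: "?p ` pverts (graph_union G H) = p ` pverts G \<union> p' ` pverts H"
    by (simp only: graph_union_simps image_Un pG[OF subset_refl] pH[OF subset_refl])
  fix u v assume uv: "(u, v) \<in> parcs (graph_union G H)"
  then consider "(u, v) \<in> parcs G" | "(u, v) \<in> parcs H" by auto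
  then have 1: "Path_Connected.arc (?c {u, v}) \<and> {pathstart (?c {u, v}), pathfinish (?c {u, v})} = {?p u, ?p v}
    \<and> path_image (?c {u, v}) \<inter> ?p ` pverts (graph_union G H) = {?p u, ?p v}"
  proof cases
    case 1
    have "path_image (c {u, v}) \<inter> p' ` pverts H = {}"
      using cG(4)[OF 1] vH far by blast
    then show ?thesis
      unfolding img cG(1)[OF 1] using plane_drawingD(2-4)[OF G(2) 1] cG[OF 1]
      by (simp add: Int_Un_distrib)
  next
    case 2
    have "path_image (c' {u, v}) \<inter> p ` pverts G = {}"
      using cH(6)[OF 2] vG far by blast
    then show ?thesis
      unfolding img cH(1)[OF 2] using plane_drawingD(2-4)[OF H(2) 2] cH[OF 2]
      by (simp add: Int_Un_distrib)
  qed
  then show "Path_Connected.arc (?c {u, v})" "{pathstart (?c {u, v}), pathfinish (?c {u, v})} = {?p u, ?p v}"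
    "path_image (?c {u, v}) \<inter> ?p ` pverts (graph_union G H) = {?p u, ?p v}"
    by blast+
  fix x y assume xy: "(x, y) \<in> parcs (graph_union G H)" and ne: "{u, v} \<noteq> {x, y}"
  consider "(u, v) \<in> parcs G" "(x, y) \<in> parcs G" | "(u, v) \<in> parcs H" "(x, y) \<in> parcs H"
    | "(u, v) \<in> parcs G" "(x, y) \<in> parcs H" | "(u, v) \<in> parcs H" "(x, y) \<in> parcs G"
    using uv xy by auto
  then show "path_image (?c {u, v}) \<inter> path_image (?c {x, y}) = ?p ` ({u, v} \<inter> {x, y})"
  proof cases
    case 1
    show ?thesis
      unfolding cG(1)[OF 1(1)] cG(1)[OF 1(2)] plane_drawingD(5)[OF G(2) 1 ne]
      using cG(2,3)[OF 1(1)] by (intro pG[symmetric]) auto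
  next
    case 2
    show ?thesis
      unfolding cH(1)[OF 2(1)] cH(1)[OF 2(2)] plane_drawingD(5)[OF H(2) 2 ne]
      using cH(2,3)[OF 2(1)] by (intro pH[symmetric]) auto
  next
    case 3
    have "{u, v} \<inter> {x, y} = {}"
      using cG(2,3)[OF 3(1)] cH(4,5)[OF 3(2)] by auto
    then show ?thesis
      unfolding cG(1)[OF 3(1)] cH(1)[OF 3(2)]
      using cG(4)[OF 3(1)] cH(6)[OF 3(2)] far by (simp del: Int_insert_left Int_insert_right) blast
  next
    case 4
    have "{u, v} \<inter> {x, y} = {}"
      using cG(2,3)[OF 4(2)] cH(4,5)[OF 4(1)] by auto
    then show ?thesis
      unfolding cG(1)[OF 4(2)] cH(1)[OF 4(1)]
      using cG(4)[OF 4(2)] cH(6)[OF 4(1)] far by (simp del: Int_insert_left Int_insert_right) blast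
  qed
qed

lemma planar_graph_union:
  assumes "planar_graph G" "planar_graph H" and disj: "pverts G \<inter> pverts H = {}"
  shows "planar_graph (graph_union G H)"
proof -
  obtain p c where G: "pair_graph G" "plane_drawing G p c"
    using assms by (auto simp: planar_graph_def)
  obtain p' c' where H: "pair_graph H" "plane_drawing H p' c'"
    using assms by (auto simp: planar_graph_def)
  interpret G: pair_graph G by (rule G)
  interpret H: pair_graph H by (rule H)
  have "bounded (drawing_set G p c \<union> drawing_set H p' c')"
    using bounded_drawing_set G H by auto
  then obtain B where B: "\<And>z. z \<in> drawing_set G p c \<Longrightarrow> norm z \<le> B" "\<And>z. z \<in> drawing_set H p' c' \<Longrightarrow> norm z \<le> B"
    unfolding bounded_iff by blast
  \<comment> \<open>A shift by more than the diameter of a disc around 0 containing both drawings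
    separates them. The absolute value covers empty drawings, where \<open>B\<close> may be
    negative.\<close>
  define w where "w = complex_of_real (2 * \<bar>B\<bar> + 1)"
  have shift: "drawing_set H (\<lambda>v. w + p' v) (\<lambda>e t. w + c' e t) = (+) w ` drawing_set H p' c'"
    by (auto simp: drawing_set_def path_image_def image_Un image_UN image_image)
  have "False" if "z \<in> drawing_set G p c" "w + z' = z" "z' \<in> drawing_set H p' c'" for z z'
  proof -
    have "norm w \<le> norm z + norm z'"
      using that(2) norm_triangle_ineq4[of z z'] by (simp flip: that(2))
    moreover have "norm w = 2 * \<bar>B\<bar> + 1"
      unfolding w_def norm_of_real by simp
    ultimately show False using B(1)[OF that(1)] B(2)[OF that(3)] by linarith
  qed
  then have "drawing_set G p c \<inter> drawing_set H (\<lambda>v. w + p' v) (\<lambda>e t. w + c' e t) = {}"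
    unfolding shift by blast
  from plane_drawing_union[OF G H(1) plane_drawing_translate[OF H(2)] disj this]
  have "\<exists>p c. plane_drawing (graph_union G H) p c" by blast
  moreover have "pair_graph (graph_union G H)"
    unfolding graph_union_def
  proof (rule pair_graphI)
    show "sym (parcs G \<union> parcs H)"
      using G.pair_sym_arcs H.pair_sym_arcs by (auto simp: symmetric_def intro: sym_Un)
    show "irrefl (parcs G \<union> parcs H)"
      using G.no_loops' H.no_loops' by (auto simp: irrefl_def)
  qed (auto dest: G.in_arcsD1 G.in_arcsD2 H.in_arcsD1 H.in_arcsD2
        simp: G.pair_finite_verts H.pair_finite_verts)
  ultimately show ?thesis
    by (simp add: planar_graph_def)
qed

section \<open>Deletion lower bounds\<close>

text \<open>At least \<open>d\<close> vertices must be deleted to reach maximum degree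
  \<open>k\<close>; the additive form avoids truncated subtraction.\<close>

definition deletion_bound :: "nat \<Rightarrow> 'a pair_pre_digraph \<Rightarrow> nat \<Rightarrow> bool" where
  "deletion_bound k G d \<longleftrightarrow>
     (\<forall>I \<subseteq> pverts G. (\<forall>v \<in> I. card {u \<in> I. (v, u) \<in> parcs G} \<le> k) \<longrightarrow> card I + d \<le> card (pverts G))"

lemma deletion_boundD:
  assumes "deletion_bound k G d" "I \<subseteq> pverts G" "\<And>v. v \<in> I \<Longrightarrow> card {u \<in> I. (v, u) \<in> parcs G} \<le> k"
  shows "card I + d \<le> card (pverts G)"
  using assms unfolding deletion_bound_def by blast

lemma max_degree_induced_le_iff:
  assumes "finite I"
  shows "max_degree (with_proj G \<restriction> I) \<le> k \<longleftrightarrow> (\<forall>v \<in> I. card {u \<in> I. (v, u) \<in> parcs G} \<le> k)"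
proof -
  have "out_degree (with_proj G \<restriction> I) v = card {u \<in> I. (v, u) \<in> parcs G}" if "v \<in> I" for v
  proof -
    have "out_arcs (with_proj G \<restriction> I) v = Pair v ` {u \<in> I. (v, u) \<in> parcs G}"
      using that by (auto simp: out_arcs_def)
    then show ?thesis
      by (simp add: out_degree_def card_image inj_on_def)
  qed
  then show ?thesis
    using assms by (simp add: max_degree_le_iff)
qed

text \<open>
  A hub \<open>v\<close> that is kept together with \<open>r\<close> adjacent hubs has at least \<open>r + 1\<close> deleted leaves. As the hubs at a
  leaf form a clique, each of these leaves has at most \<open>r + 1\<close> kept hubs. When every deleted leaf
  distributes weight \<open>1\<close> evenly among its kept hubs, every kept hub hence receives at least \<open>1\<close>, so there
  are at least as many deleted leaves as kept hubs.
\<close>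
lemma deletion_bound_hubs:
  fixes G :: "'a pair_pre_digraph"
  assumes fin: "finite (pverts G)" and sub: "H \<subseteq> pverts G" "L \<subseteq> pverts G" and disj: "H \<inter> L = {}"
    and leaves: "\<And>v. v \<in> H \<Longrightarrow> k + 1 \<le> card {l \<in> L. (v, l) \<in> parcs G}"
    and clique: "\<And>l u v. l \<in> L \<Longrightarrow> u \<in> H \<Longrightarrow> v \<in> H \<Longrightarrow> (u, l) \<in> parcs G \<Longrightarrow> (v, l) \<in> parcs G \<Longrightarrow>
                   u \<noteq> v \<Longrightarrow> (u, v) \<in> parcs G"
  shows "deletion_bound k G (card H)"
  unfolding deletion_bound_def
proof (intro allI impI)
  fix I assume I: "I \<subseteq> pverts G" and deg: "\<forall>v \<in> I. card {u \<in> I. (v, u) \<in> parcs G} \<le> k"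
  define B where "B = H \<inter> I"
  define D where "D = L - I"
  define m where "m l = card {v \<in> B. (v, l) \<in> parcs G}" for l
  have fin': "finite H" "finite L" "finite I"
    using fin sub I by (blast intro: finite_subset)+
  then have fin'': "finite B" "finite D"
    by (simp_all add: B_def D_def)
  have gets: "1 \<le> (\<Sum>l\<in>{l \<in> D. (v, l) \<in> parcs G}. 1 / real (m l))" if v: "v \<in> B" for v
  proof -
    define r where "r = card {u \<in> B. (v, u) \<in> parcs G}"
    define X where "X = {l \<in> D. (v, l) \<in> parcs G}"
    have "{l \<in> L. (v, l) \<in> parcs G} = X \<union> {l \<in> L \<inter> I. (v, l) \<in> parcs G}"
      by (auto simp: X_def D_def)
    then have 1: "k + 1 \<le> card X + card {l \<in> L \<inter> I. (v, l) \<in> parcs G}"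
      using leaves[of v] v card_Un_le[of X "{l \<in> L \<inter> I. (v, l) \<in> parcs G}"] by (simp add: B_def)
    \<comment> \<open>Kept hubs and kept leaves at \<open>v\<close> are disjoint sets among its at
      most \<open>k\<close> kept neighbours. So at most \<open>k - r\<close> of its at least
      \<open>k + 1\<close> leaves are kept.\<close>
    have "card {u \<in> B. (v, u) \<in> parcs G} + card {l \<in> L \<inter> I. (v, l) \<in> parcs G}
        = card ({u \<in> B. (v, u) \<in> parcs G} \<union> {l \<in> L \<inter> I. (v, l) \<in> parcs G})"
      using fin' fin'' disj by (intro card_Un_disjoint[symmetric]) (auto simp: B_def)
    also have "\<dots> \<le> card {u \<in> I. (v, u) \<in> parcs G}"
      using fin' by (intro card_mono) (auto simp: B_def)
    also have "\<dots> \<le> k"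
      using deg v by (simp add: B_def)
    finally have X: "r + 1 \<le> card X"
      using 1 by (simp add: r_def)
    have "1 / real (r + 1) \<le> 1 / real (m l)" if l: "l \<in> X" for l
    proof -
      have "{u \<in> B. (u, l) \<in> parcs G} \<subseteq> insert v {u \<in> B. (v, u) \<in> parcs G}"
        using clique[of l v] l v by (auto simp: X_def D_def B_def)
      then have "m l \<le> card (insert v {u \<in> B. (v, u) \<in> parcs G})"
        unfolding m_def using fin'' by (intro card_mono) auto
      also have "\<dots> \<le> r + 1"
        unfolding r_def using fin'' by (simp add: card_insert_if)
      finally have "m l \<le> r + 1" .
      \<comment> \<open>Positivity of \<open>m l\<close> is needed for the comparison, as division
        by 0 yields 0.\<close>
      moreover have "v \<in> {u \<in> B. (u, l) \<in> parcs G}"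
        using l v by (simp add: X_def)
      then have "0 < m l"
        unfolding m_def using fin'' by (subst card_gt_0_iff) auto
      ultimately show ?thesis
        by (intro divide_left_mono) simp_all
    qed
    then have "(\<Sum>l\<in>X. 1 / real (r + 1)) \<le> (\<Sum>l\<in>X. 1 / real (m l))"
      by (rule sum_mono)
    moreover have "1 \<le> (\<Sum>l\<in>X. 1 / real (r + 1))"
      using X by (simp add: field_simps)
    ultimately show ?thesis
      unfolding X_def by linarith
  qed
  have "real (card B) \<le> (\<Sum>v\<in>B. \<Sum>l\<in>{l \<in> D. (v, l) \<in> parcs G}. 1 / real (m l))"
    using sum_mono[OF gets] by simp
  also have "\<dots> = (\<Sum>l\<in>D. \<Sum>v\<in>{v \<in> B. (v, l) \<in> parcs G}. 1 / real (m l))"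
    using fin'' by (intro sum.swap_restrict)
  \<comment> \<open>A deleted leaf with a kept hub hands out exactly 1 in total; one without kept
    hubs contributes the empty sum 0.\<close>
  also have "\<dots> \<le> (\<Sum>l\<in>D. 1)"
    by (intro sum_mono) (simp add: m_def)
  finally have BD: "card B \<le> card D"
    by simp
  \<comment> \<open>Deleted leaves replace kept hubs in the count; together with the deleted hubs
    they are distinct deleted vertices.\<close>
  have "card H = card B + card (H - I)"
    unfolding B_def using fin' by (subst card_Un_disjoint[symmetric]) (auto intro!: arg_cong[of _ _ card])
  also have "\<dots> \<le> card D + card (H - I)"
    using BD by simp
  also have "\<dots> = card (D \<union> (H - I))"
    using fin' fin'' disj by (intro card_Un_disjoint[symmetric]) (auto simp: D_def)
  also have "\<dots> \<le> card (pverts G - I)"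
    using fin sub by (intro card_mono) (auto simp: D_def)
  finally show "card I + card H \<le> card (pverts G)"
    using card_Diff_subset[OF fin'(3) I] card_mono[OF fin I] by simp
qed

text \<open>With labels in \<open>nat\<close>, disjoint copies arise by shifting, so achievable
  pairs \<open>(n, d)\<close> can be added.\<close>

definition planar_deletion :: "nat \<Rightarrow> nat \<Rightarrow> nat \<Rightarrow> bool" where
  "planar_deletion k n d \<longleftrightarrow>
     (\<exists>G :: nat pair_pre_digraph. planar_graph G \<and> card (pverts G) = n \<and> deletion_bound k G d)"

lemma planar_graph_finite: "planar_graph G \<Longrightarrow> finite (pverts G)"
  by (simp add: planar_graph_def pair_graph_def pair_digraph_def pair_fin_digraph_def
      pair_fin_digraph_axioms_def)

text \<open>A kept set splits into one part per component, and passing to a part does not increase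
  degrees, so both deletion bounds apply.\<close>

lemma planar_deletion_add:
  assumes "planar_deletion k n d" "planar_deletion k n' d'"
  shows "planar_deletion k (n + n') (d + d')"
proof -
  obtain G :: "nat pair_pre_digraph" where G: "planar_graph G" "card (pverts G) = n" "deletion_bound k G d"
    using assms(1) by (auto simp: planar_deletion_def)
  obtain H :: "nat pair_pre_digraph" where H: "planar_graph H" "card (pverts H) = n'" "deletion_bound k H d'"
    using assms(2) by (auto simp: planar_deletion_def)
  have fin: "finite (pverts G)" "finite (pverts H)"
    using G H planar_graph_finite by auto
  obtain s where s: "\<forall>v \<in> pverts G. v < s"
    using finite_nat_set_iff_bounded fin by blast
  define f where "f = (\<lambda>v. s + v)"
  define H' where "H' = \<lparr>pverts = f ` pverts H, parcs = map_prod f f ` parcs H\<rparr>"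
  have f: "inj f" by (auto simp: f_def)
  have disj: "pverts G \<inter> pverts H' = {}"
    using s by (fastforce simp: H'_def f_def)
  have "planar_graph (graph_union G H')"
    using planar_graph_map[OF H(1) f] G(1) disj by (intro planar_graph_union) (simp_all add: H'_def)
  moreover have card: "card (pverts (graph_union G H')) = n + n'"
    using fin disj G H f by (simp add: card_Un_disjoint H'_def card_image inj_on_subset)
  moreover have "deletion_bound k (graph_union G H') (d + d')"
    unfolding deletion_bound_def card
  proof (intro allI impI)
    fix I assume I: "I \<subseteq> pverts (graph_union G H')"
      and deg: "\<forall>v \<in> I. card {u \<in> I. (v, u) \<in> parcs (graph_union G H')} \<le> k"
    have finI: "finite I" using I fin finite_subset by (fastforce simp: H'_def)
    have "card (I \<inter> pverts G) + d \<le> n"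
      unfolding G(2)[symmetric]
    proof (rule deletion_boundD[OF G(3)])
      fix v assume v: "v \<in> I \<inter> pverts G"
      have "card {u \<in> I \<inter> pverts G. (v, u) \<in> parcs G} \<le> card {u \<in> I. (v, u) \<in> parcs (graph_union G H')}"
        using finI by (intro card_mono) auto
      then show "card {u \<in> I \<inter> pverts G. (v, u) \<in> parcs G} \<le> k"
        using deg v by (meson IntD1 le_trans)
    qed auto
    moreover have "card (f -` I \<inter> pverts H) + d' \<le> n'"
      unfolding H(2)[symmetric]
    proof (rule deletion_boundD[OF H(3)])
      fix v assume v: "v \<in> f -` I \<inter> pverts H"
      have "card {u \<in> f -` I \<inter> pverts H. (v, u) \<in> parcs H}
          = card (f ` {u \<in> f -` I \<inter> pverts H. (v, u) \<in> parcs H})"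
        using f by (simp add: card_image inj_on_subset)
      also have "\<dots> \<le> card {u \<in> I. (f v, u) \<in> parcs (graph_union G H')}"
        using finI by (intro card_mono) (auto simp: H'_def)
      also have "\<dots> \<le> k" using deg v by auto
      finally show "card {u \<in> f -` I \<inter> pverts H. (v, u) \<in> parcs H} \<le> k" .
    qed auto
    moreover have "card I = card (I \<inter> pverts G) + card (f -` I \<inter> pverts H)"
    proof -
      have "I = (I \<inter> pverts G) \<union> f ` (f -` I \<inter> pverts H)"
        using I by (auto simp: H'_def)
      then have "card I = card ((I \<inter> pverts G) \<union> f ` (f -` I \<inter> pverts H))" by simp
      also have "\<dots> = card (I \<inter> pverts G) + card (f ` (f -` I \<inter> pverts H))"
        using disj fin by (intro card_Un_disjoint) (auto simp: H'_def)
      finally show ?thesis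
        using f by (simp add: card_image inj_on_subset)
    qed
    ultimately show "card I + (d + d') \<le> n + n'" by simp
  qed
  ultimately show ?thesis
    unfolding planar_deletion_def by blast
qed

lemma planar_deletion_empty: "planar_deletion k 0 0"
proof -
  have "plane_drawing (ugraph {} {}) p c" for p :: "nat \<Rightarrow> complex" and c
    by (rule plane_drawingI) auto
  then have "planar_graph (ugraph {} {} :: nat pair_pre_digraph)"
    unfolding planar_graph_def by (auto intro!: pair_graph_ugraph simp: irrefl_def)
  then show ?thesis
    unfolding planar_deletion_def
    by (intro exI[of _ "ugraph {} {}"]) (auto simp: deletion_bound_def)
qed

text \<open>Drawn directly, because the straight-line criterion asks for an edge at every
  vertex.\<close>

lemma planar_deletion_vertex: "planar_deletion k 1 0"
proof -
  have "plane_drawing (ugraph {0} {}) p c" for p :: "nat \<Rightarrow> complex" and c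
    by (rule plane_drawingI) auto
  then have "planar_graph (ugraph {0} {} :: nat pair_pre_digraph)"
    unfolding planar_graph_def by (auto intro!: pair_graph_ugraph simp: irrefl_def)
  then show ?thesis
    unfolding planar_deletion_def
    by (intro exI[of _ "ugraph {0} {}"]) (auto simp: deletion_bound_def intro: card_mono[of "{0}", simplified])
qed

lemma planar_deletion_mult: "planar_deletion k n d \<Longrightarrow> planar_deletion k (q * n) (q * d)"
  by (induction q) (auto intro: planar_deletion_empty planar_deletion_add)

lemma planar_deletion_isolated: "planar_deletion k n d \<Longrightarrow> planar_deletion k (n + r) d"
  using planar_deletion_add[OF _ planar_deletion_mult[OF planar_deletion_vertex, of k r]] by simp

section \<open>Two adjacent hubs\<close>

text \<open>The triangular book: \<open>m\<close> triangles sharing the edge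
  \<open>{0, 1}\<close>.\<close>

definition book_arcs :: "nat \<Rightarrow> nat rel" where
  "book_arcs m = insert (0, 1) ({0, 1} \<times> {2..<m + 2})"

text \<open>The hubs lie left and right of the vertical axis and the leaves on it at distinct
  positive heights. Edges at different hubs can meet only on the axis, and the edge between the hubs
  passes below all leaves.\<close>

lemma planar_book: "1 \<le> m \<Longrightarrow> planar_graph (ugraph {..<m + 2} (book_arcs m))"
proof (rule planar_straight_line[where q = "\<lambda>v. if v = 0 then (-1, 0) else if v = 1 then (1, 0) else (0, int v)"])
  assume m: "1 \<le> m"
  have "v \<in> Field (book_arcs m)" if "v < m + 2" for v
  proof -
    have "(0, if v < 2 then 1 else v) \<in> book_arcs m" "(if v = 0 then 0 else v) \<in> {v}"
      using that by (auto simp: book_arcs_def)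
    then show ?thesis
      by (cases "v = 0 \<or> v = 1") (auto simp: Field_def split: if_splits)
  qed
  then show "{..<m + 2} \<subseteq> Field (book_arcs m)" by auto
next
  fix e f assume "e \<in> book_arcs m" "f \<in> book_arcs m"
  then show "noncrossing (\<lambda>v. if v = 0 then (-1, 0) else if v = 1 then (1, 0) else (0, int v)) e f"
    by (auto simp: book_arcs_def noncrossing_def cross_def zero_less_mult_iff mult_less_0_iff)
qed (auto simp: book_arcs_def irrefl_def inj_on_def)

lemma planar_deletion_book: "planar_deletion k (k + 3) 2"
proof -
  \<comment> \<open>The \<open>k + 1\<close> pages are the leaves that each of the two hubs
    needs.\<close>
  let ?G = "ugraph {..<(k + 1) + 2} (book_arcs (k + 1))"
  have "deletion_bound k ?G (card {0, 1::nat})"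
  proof (rule deletion_bound_hubs[where L = "{2..<k + 3}"])
    fix v :: nat assume "v \<in> {0, 1}"
    then have "{l \<in> {2..<k + 3}. (v, l) \<in> parcs ?G} = {2..<k + 3}"
      by (auto simp: book_arcs_def)
    then show "k + 1 \<le> card {l \<in> {2..<k + 3}. (v, l) \<in> parcs ?G}"
      by simp
  qed (auto simp: book_arcs_def)
  then have "deletion_bound k ?G 2" by (simp add: numeral_2_eq_2)
  then show ?thesis
    unfolding planar_deletion_def using planar_book[of "k + 1"]
    by (intro exI[of _ ?G]) auto
qed

section \<open>An octahedron of hubs\<close>

text \<open>
  The hubs are \<open>0, \<dots>, 5\<close>, with \<open>i\<close> and \<open>i + 3\<close> antipodal, and \<open>6, \<dots>, 13\<close> are the leaves in the eight
  faces. Each further triple \<open>14 + 3 i, 15 + 3 i, 16 + 3 i\<close> puts one more leaf on each edge of the perfect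
  matching \<open>{0, 1}, {2, 3}, {4, 5}\<close>, which gives every hub one more leaf. For \<open>k \<le> 6\<close> the
  first \<open>3 k + 5\<close> vertices thus provide every hub with exactly \<open>k + 1\<close> leaves.
\<close>
definition octa_coords :: "(int \<times> int) list" where
  "octa_coords = [(4,4), (9,1), (0,2), (12,0), (6,8), (8,3), (1,2), (8,2), (4,5), (5,4), (7,1), (9,2),
     (6,9), (11,1), (5,2), (4,1), (7,6), (7,2), (3,1), (9,3), (2,2), (2,1), (10,2)]"

text \<open>The first 12 pairs form the octahedron, the next 24 attach the face leaves, and the last
  18 the matching leaves. The smaller end comes first, so a leaf is always a second
  component.\<close>

definition octa_edges :: "(nat \<times> nat) list" where
  "octa_edges =
    [(0, 1), (0, 2), (0, 4), (0, 5), (1, 2), (1, 3), (1, 5), (2, 3), (2, 4), (3, 4), (3, 5), (4, 5),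
     (0, 6), (1, 6), (2, 6), (0, 7), (1, 7), (5, 7), (0, 8), (4, 8), (2, 8), (0, 9), (4, 9), (5, 9),
     (3, 10), (1, 10), (2, 10), (3, 11), (1, 11), (5, 11), (3, 12), (4, 12), (2, 12), (3, 13), (4, 13), (5, 13),
     (0, 14), (1, 14), (2, 15), (3, 15), (4, 16), (5, 16), (0, 17), (1, 17), (2, 18), (3, 18), (4, 19), (5, 19),
     (0, 20), (1, 20), (2, 21), (3, 21), (4, 22), (5, 22)]"

text \<open>One evaluation on the full graph with 23 vertices, the case \<open>k = 6\<close>; the
  graphs for smaller \<open>k\<close> are subgraphs in the same drawing.\<close>

lemma octa_noncrossing:
  "list_all (\<lambda>e. list_all (noncrossing (\<lambda>v. octa_coords ! v) e) octa_edges) octa_edges"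
  by code_simp

lemma octa_edges_bounds: "list_all (\<lambda>(u, v). u < 6 \<and> u < v \<and> v < 23) octa_edges"
  by code_simp

text \<open>Vertex 0 is left out because it is never the larger end of an edge.\<close>

lemma octa_no_isolated: "list_all (\<lambda>v. list_ex (\<lambda>(u, w). w = v) octa_edges) [1..<23]"
  by code_simp

lemma octa_leaves:
  "list_all (\<lambda>k. list_all (\<lambda>v. k + 1 \<le> length (filter (\<lambda>l. (v, l) \<in> set octa_edges) [6..<3 * k + 5])) [0..<6]) [3..<7]"
  by code_simp

text \<open>The hubs at a leaf span a face or a matching edge. The disjunct \<open>l < 6\<close>
  exempts pairs of edges that meet in a hub.\<close>

lemma octa_clique:
  "list_all (\<lambda>(u, l). list_all (\<lambda>(v, l').
     if l = l' then l < 6 \<or> u = v \<or> (u, v) \<in> set octa_edges \<or> (v, u) \<in> set octa_edges else True) octa_edges) octa_edges"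
  by code_simp

lemma octa_coords_distinct: "distinct octa_coords" "length octa_coords = 23"
  by code_simp+

text \<open>Since \<open>3 * k + 5 = 14 + 3 * (k - 3)\<close> for \<open>3 \<le> k\<close>, the
  cutoff keeps all face leaves and \<open>k - 3\<close> matching triples.\<close>

definition octa_arcs :: "nat \<Rightarrow> nat rel" where
  "octa_arcs k = {(u, v) \<in> set octa_edges. v < 3 * k + 5}"

lemma octa_arcsD: "(u, v) \<in> octa_arcs k \<Longrightarrow> (u, v) \<in> set octa_edges \<and> u < 6 \<and> u < v \<and> v < 3 * k + 5"
  using octa_edges_bounds by (auto simp: octa_arcs_def list_all_iff)

lemma planar_octa:
  assumes "k \<le> 6"
  shows "planar_graph (ugraph {..<3 * k + 5} (octa_arcs k))"
proof (rule planar_straight_line[where q = "\<lambda>v. octa_coords ! v"])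
  show "octa_arcs k \<subseteq> {..<3 * k + 5} \<times> {..<3 * k + 5}"
    by (auto dest!: octa_arcsD)
  show "irrefl (octa_arcs k)"
    by (auto simp: irrefl_def dest!: octa_arcsD)
  show "inj_on (\<lambda>v. octa_coords ! v) {..<3 * k + 5}"
    using assms octa_coords_distinct by (auto simp: inj_on_def nth_eq_iff_index_eq)
  show "{..<3 * k + 5} \<subseteq> Field (octa_arcs k)"
  proof
    fix v assume v: "v \<in> {..<3 * k + 5}"
    show "v \<in> Field (octa_arcs k)"
    proof (cases "v = 0")
      case True
      have "(0, 1) \<in> octa_arcs k" by (simp add: octa_arcs_def octa_edges_def)
      then show ?thesis using True by (auto simp: Field_def)
    next
      case False
      then have "v \<in> set [1..<23]" using v assms by auto
      then obtain u where "(u, v) \<in> set octa_edges"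
        using octa_no_isolated unfolding list_all_iff list_ex_iff by fast
      then show ?thesis using v by (auto simp: Field_def octa_arcs_def)
    qed
  qed
  fix e f assume "e \<in> octa_arcs k" "f \<in> octa_arcs k"
  then have "e \<in> set octa_edges" "f \<in> set octa_edges" by (auto simp: octa_arcs_def)
  then show "noncrossing (\<lambda>v. octa_coords ! v) e f"
    using octa_noncrossing unfolding list_all_iff by blast
qed simp

lemma planar_deletion_octa:
  assumes "3 \<le> k" "k \<le> 6"
  shows "planar_deletion k (3 * k + 5) 6"
proof -
  let ?G = "ugraph {..<3 * k + 5} (octa_arcs k)"
  \<comment> \<open>No listed pair starts with a leaf, so the converse adds no arc into a
    leaf.\<close>
  have arc_iff: "(u, l) \<in> parcs ?G \<longleftrightarrow> (u, l) \<in> set octa_edges" if "6 \<le> l" "l < 3 * k + 5" for u l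
    using that octa_arcsD[of l u k] by (auto simp: octa_arcs_def)
  have "deletion_bound k ?G (card {..<6::nat})"
  proof (rule deletion_bound_hubs[where L = "{6..<3 * k + 5}"])
    fix v :: nat assume "v \<in> {..<6}"
    then have v: "v \<in> set [0..<6]" and k: "k \<in> set [3..<7]" using assms by auto
    have "k + 1 \<le> length (filter (\<lambda>l. (v, l) \<in> set octa_edges) [6..<3 * k + 5])"
      using octa_leaves v k unfolding list_all_iff by blast
    also have "\<dots> = card (set (filter (\<lambda>l. (v, l) \<in> set octa_edges) [6..<3 * k + 5]))"
      by (subst distinct_card) simp_all
    also have "set (filter (\<lambda>l. (v, l) \<in> set octa_edges) [6..<3 * k + 5])
        = {l \<in> {6..<3 * k + 5}. (v, l) \<in> parcs ?G}"
      using arc_iff by auto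
    finally show "k + 1 \<le> card {l \<in> {6..<3 * k + 5}. (v, l) \<in> parcs ?G}" .
  next
    fix l u v :: nat
    assume l: "l \<in> {6..<3 * k + 5}" and uv: "u \<in> {..<6}" "v \<in> {..<6}" "u \<noteq> v"
      and "(u, l) \<in> parcs ?G" "(v, l) \<in> parcs ?G"
    then have "(u, l) \<in> set octa_edges" "(v, l) \<in> set octa_edges"
      using arc_iff by auto
    then have "(u, v) \<in> set octa_edges \<or> (v, u) \<in> set octa_edges"
      using octa_clique l uv(3) unfolding list_all_iff by fastforce
    then show "(u, v) \<in> parcs ?G"
      using uv assms(1) by (auto simp: octa_arcs_def)
  qed (use assms in auto)
  then show ?thesis
    unfolding planar_deletion_def using planar_octa[OF assms(2)]
    by (intro exI[of _ ?G]) auto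
qed

section \<open>Numerical estimates and assembly of the extremal graph\<close>

lemma planar_deletion_imp:
  assumes "planar_deletion k n d" "real n - real d \<le> \<mu>"
  shows "\<exists>G :: nat pair_pre_digraph. planar_graph G \<and> card (pverts G) = n \<and>
           (\<forall>I \<subseteq> pverts G. max_degree (with_proj G \<restriction> I) \<le> k \<longrightarrow> real (card I) \<le> \<mu>)"
proof -
  obtain G :: "nat pair_pre_digraph" where G: "planar_graph G" "card (pverts G) = n" "deletion_bound k G d"
    using assms(1) by (auto simp: planar_deletion_def)
  have "real (card I) \<le> \<mu>" if I: "I \<subseteq> pverts G" and deg: "max_degree (with_proj G \<restriction> I) \<le> k" for I
  proof -
    have "finite I" using I planar_graph_finite[OF G(1)] finite_subset by blast
    then have "card I + d \<le> card (pverts G)"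
      using deletion_boundD[OF G(3) I] deg by (simp add: max_degree_induced_le_iff)
    then show ?thesis using assms(2) G(2) by linarith
  qed
  then show ?thesis using G by blast
qed

text \<open>The two bounds ask for \<open>3 n / (2 k + 1) - 5\<close> and
  \<open>2 n / (k + 4) - 2\<close> deletions. For the second, every copy pays for itself and
  \<open>r \<le> k + 2\<close> vertices cost less than 2. For the first, octahedra pay for
  themselves as \<open>6 / (3 k + 5) \<ge> 3 / (2 k + 1)\<close>; the remaining vertices cost at
  most 7, covered by 5 and the 2 deletions of a book, and less than 5 if there is no book.\<close>

lemma octa_book_bound:
  fixes q q' r k n :: nat
  assumes k: "3 \<le> k" "k \<le> 6" and n: "n = q * (3 * k + 5) + (q' * (k + 3) + r)"
    and r: "r < k + 3" "q' * (k + 3) + r < 3 * k + 5"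
  shows "real n - real (q * 6 + q' * 2) \<le> min ((2 * real k - 2) / (2 * real k + 1) * real n + 5)
                     ((real k + 2) / (real k + 4) * real n + 2)"
proof -
  \<comment> \<open>Fixing \<open>k\<close> turns all coefficients into numerals, which makes the
    inequalities linear.\<close>
  consider "k = 3" | "k = 4" | "k = 5" | "k = 6" using k by linarith
  then show ?thesis
  proof cases
    case 1
    have "n = 14 * q + (6 * q' + r)" "r \<le> 5" "6 * q' + r \<le> 13" using n r unfolding 1 by simp_all
    then show ?thesis unfolding 1 by (cases "q' = 0") (simp_all add: field_simps)
  next
    case 2
    have "n = 17 * q + (7 * q' + r)" "r \<le> 6" "7 * q' + r \<le> 16" using n r unfolding 2 by simp_all
    then show ?thesis unfolding 2 by (cases "q' = 0") (simp_all add: field_simps)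
  next
    case 3
    have "n = 20 * q + (8 * q' + r)" "r \<le> 7" "8 * q' + r \<le> 19" using n r unfolding 3 by simp_all
    then show ?thesis unfolding 3 by (cases "q' = 0") (simp_all add: field_simps)
  next
    case 4
    have "n = 23 * q + (9 * q' + r)" "r \<le> 8" "9 * q' + r \<le> 22" using n r unfolding 4 by simp_all
    then show ?thesis unfolding 4 by (cases "q' = 0") (simp_all add: field_simps)
  qed
qed

lemma book_bound:
  fixes q r k n :: nat
  assumes k: "7 \<le> k" and n: "n = q * (k + 3) + r" and r: "r < k + 3"
  shows "real n - real (q * 2) \<le> min ((2 * real k - 2) / (2 * real k + 1) * real n + 5)
                     ((real k + 2) / (real k + 4) * real n + 2)"
proof -
  have n': "real n = real q * (real k + 3) + real r"
    using n by simp
  have r': "real r \<le> real k + 2" and k': "7 \<le> real k"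
    using r k by linarith+
  \<comment> \<open>The only nonlinear fact required:
    \<open>2 q (2 k + 1) - 3 q (k + 3) = q (k - 7)\<close> must not be negative.\<close>
  have "real q * 7 \<le> real q * real k"
    using k' by (intro mult_left_mono) auto
  then have "real n * 3 \<le> (2 * real q + 5) * (2 * real k + 1)" "real n * 2 \<le> (2 * real q + 2) * (real k + 4)"
    using r' k' unfolding n' by (simp_all add: algebra_simps)
  then show ?thesis
    by (simp add: field_simps)
qed

theorem theorem7:
  fixes n k :: nat
  assumes "n \<ge> 1" and "k \<ge> 3"
  shows "let \<mu> = min ((2 * real k - 2) / (2 * real k + 1) * real n + 5)
                     ((real k + 2) / (real k + 4) * real n + 2)
         in \<exists>G :: nat pair_pre_digraph.
              planar_graph G \<and> card (pverts G) = n \<and>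
              (\<forall>I \<subseteq> pverts G. max_degree (with_proj G \<restriction> I) \<le> k \<longrightarrow> real (card I) \<le> \<mu>)"
  unfolding Let_def
\<comment> \<open>A book forces 2 deletions on \<open>k + 3\<close> vertices, and
  \<open>2 / (k + 3) \<ge> 3 / (2 k + 1)\<close> holds exactly from \<open>k = 7\<close> on; below
  that the octahedra supply the rate for the first bound.\<close>
proof (cases "k \<le> 6")
  case True
  define m where "m = n mod (3 * k + 5)"
  define q q' r where "q = n div (3 * k + 5)" and "q' = m div (k + 3)" and "r = m mod (k + 3)"
  have m: "m = q' * (k + 3) + r" "m < 3 * k + 5"
    by (simp_all add: m_def q'_def r_def div_mult_mod_eq)
  have n: "n = q * (3 * k + 5) + (q' * (k + 3) + r)"
    unfolding m(1)[symmetric] by (simp add: m_def q_def div_mult_mod_eq)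
  have "planar_deletion k (q * (3 * k + 5) + (q' * (k + 3) + r)) (q * 6 + q' * 2)"
    by (rule planar_deletion_add[OF planar_deletion_mult[OF planar_deletion_octa[OF assms(2) True]]
          planar_deletion_isolated[OF planar_deletion_mult[OF planar_deletion_book]]])
  then have "planar_deletion k n (q * 6 + q' * 2)"
    unfolding n[symmetric] .
  moreover have "r < k + 3"
    by (simp add: r_def)
  ultimately show "\<exists>G :: nat pair_pre_digraph.
      planar_graph G \<and> card (pverts G) = n \<and>
      (\<forall>I \<subseteq> pverts G. max_degree (with_proj G \<restriction> I) \<le> k \<longrightarrow>
        real (card I) \<le> min ((2 * real k - 2) / (2 * real k + 1) * real n + 5)
                           ((real k + 2) / (real k + 4) * real n + 2))"
    using octa_book_bound[OF assms(2) True n] m by (intro planar_deletion_imp) auto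
next
  case False
  define q r where "q = n div (k + 3)" and "r = n mod (k + 3)"
  have n: "n = q * (k + 3) + r" and r: "r < k + 3"
    by (simp_all add: q_def r_def div_mult_mod_eq)
  have "planar_deletion k (q * (k + 3) + r) (q * 2)"
    by (rule planar_deletion_isolated[OF planar_deletion_mult[OF planar_deletion_book]])
  then have "planar_deletion k n (q * 2)"
    unfolding n[symmetric] .
  then show "\<exists>G :: nat pair_pre_digraph.
      planar_graph G \<and> card (pverts G) = n \<and>
      (\<forall>I \<subseteq> pverts G. max_degree (with_proj G \<restriction> I) \<le> k \<longrightarrow>
        real (card I) \<le> min ((2 * real k - 2) / (2 * real k + 1) * real n + 5)
                           ((real k + 2) / (real k + 4) * real n + 2))"
    using book_bound[OF _ n r] False by (intro planar_deletion_imp) auto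
qed

end
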